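(* Let $P\in\mathbb{R}^{n\times n}$ be an irreducible and aperiodic Markov transition matrix with strictly positive stationary distribution $\pi$. For any initial state $i\in[n]$ and times $k,t\in\mathbb{N}$, $$\chi_i^2(k+t)\le\sigma_2^2(P^t)\,\chi_i^2(k).$$
   Context: $P$ is row-stochastic ($n\ge2$), $\pi^\top P=\pi^\top$, $\pi_i>0$ for all $i\in[n]=\{1,\dots,n\}$, $\sum_i\pi_i=1$. $p^t(i,j)$ is the $(i,j)$ entry of $P^t$, and the pointwise chi-squared divergence is $\chi_i^2(t)=\sum_{j=1}^n\frac{(p^t(i,j)-\pi_j)^2}{\pi_j}$. $\ell^2(\pi)$ is $\mathbb{R}^n$ with inner product $\langle f,g\rangle_\pi=\sum_if_ig_i\pi_i$, $P^*$ is the adjoint of $P$ on $\ell^2(\pi)$, and $\sigma_i(P^t)=\sqrt{\lambda_i(P^t(P^* )^t)}$, where $\lambda_1\ge\dots\ge\lambda_n$ are the eigenvalues of $P^t(P^* )^t$ counted with multiplicity. No reversibility is assumed. *)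

theory Defs
  imports "Jordan_Normal_Form.Char_Poly"
begin

text \<open>
  The state space \<open>{1,\<dots>,n}\<close> is represented by the index set \<open>{0..<n}\<close> used by the matrix library;
  eigenvalues and singular values are nevertheless numbered from 1.
\<close>

definition row_stochastic :: "nat \<Rightarrow> real mat \<Rightarrow> bool" where
  "row_stochastic n P \<longleftrightarrow>
     P \<in> carrier_mat n n \<and>
     (\<forall>i<n. \<forall>j<n. 0 \<le> P $$ (i, j)) \<and>
     (\<forall>i<n. (\<Sum>j<n. P $$ (i, j)) = 1)"

definition irreducible_chain :: "nat \<Rightarrow> real mat \<Rightarrow> bool" where
  "irreducible_chain n P \<longleftrightarrow> (\<forall>i<n. \<forall>j<n. \<exists>t. (P ^\<^sub>m t) $$ (i, j) > 0)"

definition period :: "real mat \<Rightarrow> nat \<Rightarrow> nat" where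
  "period P i = Gcd {t. t \<ge> 1 \<and> (P ^\<^sub>m t) $$ (i, i) > 0}"

definition aperiodic_chain :: "nat \<Rightarrow> real mat \<Rightarrow> bool" where
  "aperiodic_chain n P \<longleftrightarrow> (\<forall>i<n. period P i = 1)"

definition stationary_distribution :: "nat \<Rightarrow> real mat \<Rightarrow> real vec \<Rightarrow> bool" where
  "stationary_distribution n P \<pi> \<longleftrightarrow>
     \<pi> \<in> carrier_vec n \<and>
     (\<forall>i<n. 0 \<le> \<pi> $ i) \<and>
     (\<Sum>i<n. \<pi> $ i) = 1 \<and>
     transpose_mat P *\<^sub>v \<pi> = \<pi>"

definition chi2_div :: "nat \<Rightarrow> real mat \<Rightarrow> real vec \<Rightarrow> nat \<Rightarrow> nat \<Rightarrow> real" where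
  "chi2_div n P \<pi> i t = (\<Sum>j<n. ((P ^\<^sub>m t) $$ (i, j) - \<pi> $ j)\<^sup>2 / \<pi> $ j)"

definition inner_pi :: "nat \<Rightarrow> real vec \<Rightarrow> real vec \<Rightarrow> real vec \<Rightarrow> real" where
  "inner_pi n \<pi> f g = (\<Sum>i<n. f $ i * g $ i * \<pi> $ i)"

definition is_adjoint_pi :: "nat \<Rightarrow> real vec \<Rightarrow> real mat \<Rightarrow> real mat \<Rightarrow> bool" where
  "is_adjoint_pi n \<pi> P Q \<longleftrightarrow>
     Q \<in> carrier_mat n n \<and>
     (\<forall>f \<in> carrier_vec n. \<forall>g \<in> carrier_vec n.
        inner_pi n \<pi> (P *\<^sub>v f) g = inner_pi n \<pi> f (Q *\<^sub>v g))"

text \<open>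
  The description below is well defined for positive weights, see \<open>is_adjoint_pi_iff\<close> and
  \<open>adjoint_pi_eq\<close>.
\<close>

definition adjoint_pi :: "nat \<Rightarrow> real vec \<Rightarrow> real mat \<Rightarrow> real mat" where
  "adjoint_pi n \<pi> P = (THE Q. is_adjoint_pi n \<pi> P Q)"

lemma is_adjoint_pi_iff:
  assumes P: "P \<in> carrier_mat n n" and pos: "\<And>i. i < n \<Longrightarrow> \<pi> $ i > 0"
  shows "is_adjoint_pi n \<pi> P Q \<longleftrightarrow> Q = mat n n (\<lambda>(i, j). \<pi> $ j * P $$ (j, i) / \<pi> $ i)"
    (is "_ \<longleftrightarrow> Q = ?Q")
proof
  assume adj: "is_adjoint_pi n \<pi> P Q"
  hence Q: "Q \<in> carrier_mat n n" by (simp add: is_adjoint_pi_def)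
  show "Q = ?Q"
  proof (rule eq_matI)
    fix i j assume "i < dim_row ?Q" "j < dim_col ?Q"
    hence i: "i < n" and j: "j < n" by auto
    have mult_unit: "(A *\<^sub>v unit_vec n l) $ m = A $$ (m, l)"
      if "A \<in> carrier_mat n n" "l < n" "m < n" for A :: "real mat" and l m
      using that by (auto simp: scalar_prod_right_unit)
    have "inner_pi n \<pi> (P *\<^sub>v unit_vec n i) (unit_vec n j)
        = inner_pi n \<pi> (unit_vec n i) (Q *\<^sub>v unit_vec n j)"
      using adj by (simp add: is_adjoint_pi_def)
    moreover have "inner_pi n \<pi> (P *\<^sub>v unit_vec n i) (unit_vec n j)
        = (\<Sum>m<n. if m = j then P $$ (m, i) * \<pi> $ m else 0)"
      unfolding inner_pi_def by (intro sum.cong) (use P i j mult_unit in auto)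
    moreover have "inner_pi n \<pi> (unit_vec n i) (Q *\<^sub>v unit_vec n j)
        = (\<Sum>m<n. if m = i then Q $$ (m, j) * \<pi> $ m else 0)"
      unfolding inner_pi_def by (intro sum.cong) (use Q i j mult_unit in auto)
    ultimately have "P $$ (j, i) * \<pi> $ j = Q $$ (i, j) * \<pi> $ i"
      using i j by (simp add: sum.delta)
    thus "Q $$ (i, j) = ?Q $$ (i, j)"
      using i j pos[OF i] by (simp add: field_simps)
  qed (use Q in auto)
next
  assume Q: "Q = ?Q"
  have "inner_pi n \<pi> (P *\<^sub>v f) g = inner_pi n \<pi> f (Q *\<^sub>v g)"
    if f: "f \<in> carrier_vec n" and g: "g \<in> carrier_vec n" for f g
  proof -
    have "inner_pi n \<pi> (P *\<^sub>v f) g = (\<Sum>j<n. \<Sum>i<n. P $$ (j, i) * f $ i * g $ j * \<pi> $ j)"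
      unfolding inner_pi_def using P f
      by (intro sum.cong) (auto simp: scalar_prod_def sum_distrib_right atLeast0LessThan)
    also have "\<dots> = (\<Sum>i<n. \<Sum>j<n. P $$ (j, i) * f $ i * g $ j * \<pi> $ j)"
      by (rule sum.swap)
    also have "\<dots> = inner_pi n \<pi> f (Q *\<^sub>v g)"
      unfolding inner_pi_def
    proof (rule sum.cong)
      fix i assume "i \<in> {..<n}"
      hence i: "i < n" by simp
      have "(Q *\<^sub>v g) $ i = (\<Sum>j<n. \<pi> $ j * P $$ (j, i) / \<pi> $ i * g $ j)"
        using g i unfolding Q by (auto simp: scalar_prod_def atLeast0LessThan)
      thus "(\<Sum>j<n. P $$ (j, i) * f $ i * g $ j * \<pi> $ j) = f $ i * (Q *\<^sub>v g) $ i * \<pi> $ i"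
        using pos[OF i]
        by (auto simp: sum_distrib_left sum_distrib_right field_simps intro!: sum.cong)
    qed simp
    finally show ?thesis .
  qed
  thus "is_adjoint_pi n \<pi> P Q" using Q by (auto simp: is_adjoint_pi_def)
qed

lemma adjoint_pi_eq:
  assumes "P \<in> carrier_mat n n" and "\<And>i. i < n \<Longrightarrow> \<pi> $ i > 0"
  shows "adjoint_pi n \<pi> P = mat n n (\<lambda>(i, j). \<pi> $ j * P $$ (j, i) / \<pi> $ i)"
  unfolding adjoint_pi_def using is_adjoint_pi_iff[OF assms] by (intro the_equality) auto

text \<open>
  The real eigenvalues with algebraic multiplicity, in nonincreasing order. The list has length \<open>n\<close>
  exactly when the characteristic polynomial of the \<open>n \<times> n\<close> matrix splits over the reals; this is
  the case for the matrices \<open>P\<^sup>t (P\<^sup>*)\<^sup>t\<close> used below, which are self-adjoint and positive semidefinite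
  with respect to \<open>inner_pi\<close>.
\<close>

definition eigenvalues_desc :: "real mat \<Rightarrow> real list" where
  "eigenvalues_desc A = rev (sorted_list_of_multiset (proots (char_poly A)))"

definition nth_eigenvalue :: "nat \<Rightarrow> real mat \<Rightarrow> real" where
  "nth_eigenvalue i A = eigenvalues_desc A ! (i - 1)"

definition sigma_pow :: "nat \<Rightarrow> real vec \<Rightarrow> nat \<Rightarrow> real mat \<Rightarrow> nat \<Rightarrow> real" where
  "sigma_pow n \<pi> i P t = sqrt (nth_eigenvalue i (P ^\<^sub>m t * (adjoint_pi n \<pi> P) ^\<^sub>m t))"

end

theory Submission
  imports Defs
begin

text \<open>
  Write \<open>z\<^sub>k = p\<^sup>k(i,\<cdot>)/\<pi> - 1\<close>. Then \<open>\<chi>\<^sub>i\<^sup>2(k) = \<langle>z\<^sub>k, z\<^sub>k\<rangle>\<close> in \<open>\<ell>\<^sup>2(\<pi>)\<close>, \<open>z\<^sub>k\<close> is orthogonal to the constants,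
  and \<open>z\<^bsub>k+t\<^esub> = (P\<^sup>*)\<^sup>t z\<^sub>k\<close>, so that \<open>\<chi>\<^sub>i\<^sup>2(k+t) = \<langle>z\<^sub>k, M z\<^sub>k\<rangle>\<close> with \<open>M = P\<^sup>t (P\<^sup>*)\<^sup>t\<close>. The matrix \<open>M\<close> is
  self-adjoint and stochastic, hence 1 is its largest eigenvalue, with the constants as
  eigenvectors, and its Rayleigh quotient on their orthogonal complement is at most the second
  eigenvalue. For the last point, \<open>M\<close> is symmetrized by conjugation with \<open>diag(\<surd>\<pi>)\<close> and a
  Householder reflection splits off the top eigenvector.
\<close>

section \<open>Real symmetric matrices: existence of eigenvalues and deflation\<close>

text \<open>Kept general in the scalars and bilinear, without conjugation, so that it serves both
  real matrices and their complexifications.\<close>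

lemma symmetric_scalar_prod_mult_mat_vec:
  fixes A :: "'a :: comm_semiring_0 mat"
  assumes A: "A \<in> carrier_mat n n" "transpose_mat A = A"
    and x: "x \<in> carrier_vec n" and y: "y \<in> carrier_vec n"
  shows "x \<bullet> (A *\<^sub>v y) = (A *\<^sub>v x) \<bullet> y"
proof -
  have sym: "A $$ (i, j) = A $$ (j, i)" if "i < n" "j < n" for i j
    using that A by (metis carrier_matD index_transpose_mat(1))
  have "x \<bullet> (A *\<^sub>v y) = (\<Sum>i<n. \<Sum>j<n. x $ i * A $$ (i, j) * y $ j)"
    using A x y by (auto simp: scalar_prod_def atLeast0LessThan sum_distrib_left mult.assoc intro!: sum.cong)
  also have "\<dots> = (\<Sum>j<n. \<Sum>i<n. x $ i * A $$ (i, j) * y $ j)"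
    by (rule sum.swap)
  also have "\<dots> = (A *\<^sub>v x) \<bullet> y"
    using A x y sym
    by (auto simp: scalar_prod_def atLeast0LessThan sum_distrib_left sum_distrib_right ac_simps intro!: sum.cong)
  finally show ?thesis .
qed

lemma scalar_prod_self_pos:
  fixes v :: "real vec"
  assumes "v \<in> carrier_vec n" "v \<noteq> 0\<^sub>v n"
  shows "v \<bullet> v > 0"
  using conjugate_square_greater_0_vec[OF assms(1)] assms(2) by simp

text \<open>Over the complex numbers the characteristic polynomial splits and so has a root
  \<open>a\<close>; symmetry and real entries force \<open>a = cnj a\<close>.\<close>

lemma real_symmetric_has_eigenvalue:
  fixes A :: "real mat"
  assumes A: "A \<in> carrier_mat n n" "transpose_mat A = A" and n: "n > 0"
  shows "\<exists>e. eigenvalue A e"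
proof -
  let ?C = "map_mat complex_of_real A"
  have C: "?C \<in> carrier_mat n n" "transpose_mat ?C = ?C"
    using A by (auto simp: map_mat_transpose)
  obtain as where as: "char_poly ?C = (\<Prod>a\<leftarrow>as. [:- a, 1:])" "length as = n"
    using char_poly_factorized[OF C(1)] by blast
  then obtain a where "a \<in> set as" using n by (cases as) auto
  hence root: "poly (char_poly ?C) a = 0"
    unfolding as by (simp add: poly_prod_list prod_list_zero_iff image_iff)
  then obtain v where v: "v \<in> carrier_vec n" "v \<noteq> 0\<^sub>v n" "?C *\<^sub>v v = a \<cdot>\<^sub>v v"
    using eigenvalue_root_char_poly[OF C(1)] C by (auto simp: eigenvalue_def eigenvector_def)
  have cv: "conjugate v \<in> carrier_vec n" using v by simp
  have "?C *\<^sub>v conjugate v = conjugate (?C *\<^sub>v v)"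
    using A v(1) by (auto intro!: eq_vecI simp: scalar_prod_def)
  also have "\<dots> = cnj a \<cdot>\<^sub>v conjugate v"
    using v by (auto intro!: eq_vecI)
  \<comment> \<open>Both sides evaluate the bilinear product of \<open>conjugate v\<close> with
    \<open>?C *\<^sub>v v\<close>, the left one after moving \<open>?C\<close> to the other
    factor.\<close>
  finally have "cnj a * (v \<bullet>c v) = a * (v \<bullet>c v)"
    using symmetric_scalar_prod_mult_mat_vec[OF C cv v(1)] v cv
    by (metis comm_scalar_prod scalar_prod_smult_distrib smult_scalar_prod_distrib)
  moreover have "v \<bullet>c v \<noteq> 0" using v by simp
  ultimately have "cnj a = a" by simp
  hence "a = complex_of_real (Re a)" by (simp add: complex_eq_iff)
  hence "poly (map_poly complex_of_real (char_poly A)) (complex_of_real (Re a)) = 0"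
    using root by (simp add: of_real_hom.char_poly_hom[OF A(1)])
  hence "poly (char_poly A) (Re a) = 0"
    by (simp add: of_real_hom.poly_map_poly)
  thus ?thesis using eigenvalue_root_char_poly[OF A(1)] by blast
qed

text \<open>The reflection in the hyperplane orthogonal to \<open>w = v - e0\<close> exchanges the
  unit vectors \<open>v\<close> and \<open>e0\<close>.\<close>

lemma householder_reflection:
  fixes v :: "real vec"
  assumes v: "v \<in> carrier_vec (Suc n)" "v \<bullet> v = 1"
  obtains H where "H \<in> carrier_mat (Suc n) (Suc n)" "transpose_mat H = H"
    "H * H = 1\<^sub>m (Suc n)" "H *\<^sub>v unit_vec (Suc n) 0 = v"
proof -
  let ?N = "Suc n"
  define w where "w = v - unit_vec ?N 0"
  have w: "w \<in> carrier_vec ?N" using v by (simp add: w_def)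
  define s where "s = (\<Sum>i<?N. w $ i * w $ i)"
  \<comment> \<open>For \<open>v = e\<^sub>0\<close> this is \<open>2 / 0 = 0\<close>, and \<open>H\<close> below is the identity, as needed.\<close>
  define c where "c = 2 / s"
  have v1: "(\<Sum>i<?N. v $ i * v $ i) = 1"
    using v by (simp add: scalar_prod_def atLeast0LessThan del: sum.lessThan_Suc)
  have s: "s = 2 - 2 * v $ 0"
  proof -
    have "s = (\<Sum>i<?N. v $ i * v $ i + (if i = 0 then 1 - 2 * v $ 0 else 0))"
      unfolding s_def w_def using v by (intro sum.cong) (auto simp: algebra_simps)
    also have "\<dots> = 2 - 2 * v $ 0"
      unfolding sum.distrib v1 by (subst sum.delta) auto
    finally show ?thesis .
  qed
  \<comment> \<open>The product \<open>c * s\<close> is 2 unless \<open>s = 0\<close>; in that case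
    \<open>w\<close> vanishes, so with the factor \<open>w $ i\<close> the identity holds in both
    cases.\<close>
  have csw: "c * s * w $ i = 2 * w $ i" if "i < ?N" for i
  proof (cases "s = 0")
    case True
    hence "w $ i * w $ i = 0" using that unfolding s_def
      by (subst (asm) sum_nonneg_eq_0_iff) auto
    thus ?thesis by simp
  qed (simp add: c_def)
  define H where "H = mat ?N ?N (\<lambda>(i, j). (if i = j then 1 else 0) - c * w $ i * w $ j)"
  have H: "H \<in> carrier_mat ?N ?N" by (simp add: H_def)
  have "transpose_mat H = H" by (rule eq_matI) (auto simp: H_def)
  moreover have "H * H = 1\<^sub>m ?N"
  proof (rule eq_matI)
    fix i j assume "i < dim_row (1\<^sub>m ?N)" "j < dim_col (1\<^sub>m ?N)"
    hence i: "i < ?N" and j: "j < ?N" by auto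
    have "(H * H) $$ (i, j) = (\<Sum>l<?N. H $$ (i, l) * H $$ (l, j))"
      using H i j by (simp add: scalar_prod_def atLeast0LessThan del: sum.lessThan_Suc)
    \<comment> \<open>The product of the two entries is sorted by its Kronecker deltas in
      \<open>l\<close>, so that each part can be summed separately.\<close>
    also have "\<dots> = (\<Sum>l<?N. (if l = i then (if i = j then 1 else 0) - c * w $ i * w $ j else 0)
        + (if l = j then - c * w $ i * w $ j else 0) + c * w $ i * (c * w $ j) * (w $ l * w $ l))"
      using i j by (intro sum.cong) (auto simp: H_def algebra_simps)
    also have "\<dots> = (if i = j then 1 else 0) - c * w $ i * w $ j - c * w $ i * w $ j
        + c * w $ i * (c * w $ j) * s"
      unfolding sum.distrib s_def sum_distrib_left[symmetric] using i j
      by (simp add: sum.delta del: sum.lessThan_Suc)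
    \<comment> \<open>Regrouped for \<open>csw\<close>: this term becomes twice
      \<open>c * w $ i * w $ j\<close> and cancels the two subtracted ones.\<close>
    also have "c * w $ i * (c * w $ j) * s = c * w $ i * (c * s * w $ j)" by simp
    finally show "(H * H) $$ (i, j) = 1\<^sub>m ?N $$ (i, j)"
      using i j by (simp add: csw)
  qed (use H in auto)
  moreover have "H *\<^sub>v unit_vec ?N 0 = v"
  proof (rule eq_vecI)
    fix i assume "i < dim_vec v"
    hence i: "i < ?N" using v by simp
    have "(H *\<^sub>v unit_vec ?N 0) $ i = H $$ (i, 0)"
      using H i by (auto simp: scalar_prod_right_unit)
    \<comment> \<open>Here \<open>w $ 0 = v $ 0 - 1\<close>, which is \<open>- s / 2\<close>, so
      \<open>csw\<close> applies.\<close>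
    moreover have "c * w $ i * w $ 0 = - w $ i"
      using csw[OF i] s v by (simp add: w_def algebra_simps)
    ultimately show "(H *\<^sub>v unit_vec ?N 0) $ i = v $ i"
      using i v by (simp add: H_def w_def)
  qed (use v H in auto)
  ultimately show thesis using H that by blast
qed

text \<open>Conjugation with a reflection taking \<open>e0\<close> to the normalized
  \<open>v\<close> makes \<open>A\<close> block diagonal with blocks \<open>e\<close> and
  \<open>B\<close>. Thus \<open>B\<close> represents \<open>A\<close> on the orthogonal complement
  of \<open>v\<close>, and the last clause splits \<open>x\<close> into its component
  \<open>a\<close> along \<open>v\<close> and the coordinates \<open>y\<close> of the rest.\<close>

lemma real_symmetric_deflation:
  fixes A :: "real mat"
  assumes A: "A \<in> carrier_mat (Suc n) (Suc n)" "transpose_mat A = A"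
    and v: "v \<in> carrier_vec (Suc n)" "v \<noteq> 0\<^sub>v (Suc n)" "A *\<^sub>v v = e \<cdot>\<^sub>v v"
  obtains B where "B \<in> carrier_mat n n" "transpose_mat B = B"
    "char_poly A = [:- e, 1:] * char_poly B"
    "\<And>x. x \<in> carrier_vec (Suc n) \<Longrightarrow> \<exists>a. \<exists>y \<in> carrier_vec n.
       x \<bullet> x = a\<^sup>2 + y \<bullet> y \<and> x \<bullet> (A *\<^sub>v x) = e * a\<^sup>2 + y \<bullet> (B *\<^sub>v y) \<and> (x \<bullet> v = 0 \<longrightarrow> a = 0)"
proof -
  let ?N = "Suc n" and ?e0 = "unit_vec (Suc n) 0 :: real vec"
  have vv: "v \<bullet> v > 0" using scalar_prod_self_pos[OF v(1,2)] .
  define r where "r = sqrt (v \<bullet> v)"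
  have r: "r > 0" "r * r = v \<bullet> v" using vv by (auto simp: r_def)
  define u where "u = (1 / r) \<cdot>\<^sub>v v"
  have u: "u \<in> carrier_vec ?N" using v by (simp add: u_def)
  have "u \<bullet> u = 1" using v r vv by (simp add: u_def)
  then obtain H where H: "H \<in> carrier_mat ?N ?N" "transpose_mat H = H"
    and HH: "H * H = 1\<^sub>m ?N" and He: "H *\<^sub>v ?e0 = u"
    using householder_reflection[OF u] by blast
  have HHx: "H *\<^sub>v (H *\<^sub>v x) = x" if "x \<in> carrier_vec ?N" for x
    using that H HH by (metis assoc_mult_mat_vec one_mult_mat_vec)
  have Au: "A *\<^sub>v u = e \<cdot>\<^sub>v u"
    using A v by (simp add: u_def mult_mat_vec smult_smult_assoc mult.commute)
  define M where "M = H * A * H"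
  have M: "M \<in> carrier_mat ?N ?N" using H A by (simp add: M_def)
  have Mx: "M *\<^sub>v x = H *\<^sub>v (A *\<^sub>v (H *\<^sub>v x))" if "x \<in> carrier_vec ?N" for x
    unfolding M_def using that H A by (simp add: assoc_mult_mat_vec[of _ ?N ?N _ ?N])
  have Msym: "transpose_mat M = M"
    unfolding M_def using H A
    by (simp add: transpose_mult[of _ ?N ?N _ ?N] assoc_mult_mat[of _ ?N ?N _ ?N _ ?N])
  have "M *\<^sub>v ?e0 = e \<cdot>\<^sub>v ?e0"
  proof -
    have "M *\<^sub>v ?e0 = H *\<^sub>v (e \<cdot>\<^sub>v u)" by (simp add: Mx He Au)
    also have "\<dots> = e \<cdot>\<^sub>v (H *\<^sub>v u)" using H u by (simp add: mult_mat_vec)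
    also have "H *\<^sub>v u = ?e0" using HHx[of ?e0] He by simp
    finally show ?thesis .
  qed
  moreover have "(M *\<^sub>v ?e0) $ i = M $$ (i, 0)" if "i < ?N" for i
    using that M by (simp add: scalar_prod_right_unit)
  ultimately have M0: "M $$ (i, 0) = (if i = 0 then e else 0)" if "i < ?N" for i
    using that by (metis index_smult_vec(1) index_unit_vec(1,3) mult.right_neutral mult_zero_right zero_less_Suc)
  have M_comm: "M $$ (i, j) = M $$ (j, i)" if "i < ?N" "j < ?N" for i j
    using that M Msym by (metis carrier_matD index_transpose_mat(1))
  define B where "B = mat n n (\<lambda>(i, j). M $$ (Suc i, Suc j))"
  have B: "B \<in> carrier_mat n n" by (simp add: B_def)
  \<comment> \<open>The first column is \<open>M0\<close>; the first row follows from it by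
    symmetry.\<close>
  have block: "M = four_block_mat (mat 1 1 (\<lambda>_. e)) (0\<^sub>m 1 n) (0\<^sub>m n 1) B"
  proof (rule eq_matI)
    fix i j
    assume "i < dim_row (four_block_mat (mat 1 1 (\<lambda>_. e)) (0\<^sub>m 1 n) (0\<^sub>m n 1) B)"
      and "j < dim_col (four_block_mat (mat 1 1 (\<lambda>_. e)) (0\<^sub>m 1 n) (0\<^sub>m n 1) B)"
    hence "i < ?N" "j < ?N" using B by auto
    thus "M $$ (i, j) = four_block_mat (mat 1 1 (\<lambda>_. e)) (0\<^sub>m 1 n) (0\<^sub>m n 1) B $$ (i, j)"
      using M0[of i] M0[of j] M_comm[of 0 j] B
      by (cases i; cases j) (auto simp: B_def)
  qed (use M B in auto)
  have "similar_mat A M"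
    by (rule similar_matI[of _ _ H H ?N])
       (use A M H HH in \<open>auto simp: M_def assoc_mult_mat[of _ ?N ?N _ ?N _ ?N]
         assoc_mult_mat[symmetric, of H ?N ?N H ?N _ ?N]\<close>)
  moreover have "char_poly (mat 1 1 (\<lambda>_. e)) = [:- e, 1:]"
    by (simp add: char_poly_defs det_def sign_def)
  ultimately have cp: "char_poly A = [:- e, 1:] * char_poly B"
    using char_poly_four_block_zeros_col[of "mat 1 1 (\<lambda>_. e)" "0\<^sub>m 1 n" n B] B block
    by (simp add: char_poly_similar)
  have "transpose_mat B = B"
    by (rule eq_matI) (auto simp: B_def M_comm)
  moreover have "\<exists>a. \<exists>y \<in> carrier_vec n.
       x \<bullet> x = a\<^sup>2 + y \<bullet> y \<and> x \<bullet> (A *\<^sub>v x) = e * a\<^sup>2 + y \<bullet> (B *\<^sub>v y) \<and> (x \<bullet> v = 0 \<longrightarrow> a = 0)"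
    if x: "x \<in> carrier_vec ?N" for x
  proof -
    \<comment> \<open>The coordinates of \<open>x\<close> in the orthonormal basis formed by the
      columns of \<open>H\<close>, the first of which is \<open>u\<close>. Being a symmetric
      involution, \<open>H\<close> preserves scalar products.\<close>
    define z where "z = H *\<^sub>v x"
    have z: "z \<in> carrier_vec ?N" using H x by (simp add: z_def)
    obtain a y where zy: "z = vCons a y"
      using z by (cases z) auto
    have y: "y \<in> carrier_vec n" using z zy by simp
    have Hz: "H *\<^sub>v z = x" using HHx x by (simp add: z_def)
    have My: "M *\<^sub>v z = vCons (e * a) (B *\<^sub>v y)"
    proof (rule eq_vecI)
      fix i assume "i < dim_vec (vCons (e * a) (B *\<^sub>v y))"
      hence i: "i < ?N" using B by simp
      have "(M *\<^sub>v z) $ i = (\<Sum>j<?N. M $$ (i, j) * z $ j)"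
        using M z i by (simp add: scalar_prod_def atLeast0LessThan del: sum.lessThan_Suc)
      also have "\<dots> = M $$ (i, 0) * a + (\<Sum>j<n. M $$ (i, Suc j) * y $ j)"
        using y by (simp add: sum.lessThan_Suc_shift zy del: sum.lessThan_Suc)
      also have "\<dots> = vCons (e * a) (B *\<^sub>v y) $ i"
        using i y M0 M_comm[of 0]
        by (cases i) (auto simp: B_def scalar_prod_def atLeast0LessThan)
      finally show "(M *\<^sub>v z) $ i = vCons (e * a) (B *\<^sub>v y) $ i" .
    qed (use M B in auto)
    have "x \<bullet> x = (H *\<^sub>v z) \<bullet> x" by (simp add: Hz)
    also have "\<dots> = z \<bullet> z"
      using symmetric_scalar_prod_mult_mat_vec[OF H z x] by (simp add: z_def)
    finally have "x \<bullet> x = a\<^sup>2 + y \<bullet> y" by (simp add: zy power2_eq_square)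
    moreover have "x \<bullet> (A *\<^sub>v x) = e * a\<^sup>2 + y \<bullet> (B *\<^sub>v y)"
    proof -
      have "x \<bullet> (A *\<^sub>v x) = (H *\<^sub>v z) \<bullet> (A *\<^sub>v x)" by (simp add: Hz)
      also have "\<dots> = z \<bullet> (M *\<^sub>v z)"
        using symmetric_scalar_prod_mult_mat_vec[OF H z, of "A *\<^sub>v x"] A x Mx[OF z] Hz by simp
      finally show ?thesis unfolding My by (simp add: zy power2_eq_square)
    qed
    moreover have "a = 0" if "x \<bullet> v = 0"
    proof -
      have "a = ?e0 \<bullet> z" using z zy by simp
      also have "\<dots> = u \<bullet> x"
        using symmetric_scalar_prod_mult_mat_vec[OF H _ x, of ?e0] He by (simp add: z_def)
      also have "\<dots> = 0"
        using that v x comm_scalar_prod[OF x v(1)] by (simp add: u_def)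
      finally show ?thesis .
    qed
    ultimately show ?thesis using y by blast
  qed
  ultimately show thesis using B cp that by blast
qed

section \<open>Rayleigh quotients and the two largest eigenvalues\<close>

text \<open>Induction on the dimension: deflation writes the form as \<open>e * a\<^sup>2\<close>
  plus a form in one variable fewer, and each part is at most \<open>c\<close> times its share of
  \<open>x \<bullet> x\<close>.\<close>

lemma rayleigh_quotient_le:
  fixes A :: "real mat"
  assumes "A \<in> carrier_mat n n" "transpose_mat A = A"
    and "\<And>e. poly (char_poly A) e = 0 \<Longrightarrow> e \<le> c" and "x \<in> carrier_vec n"
  shows "x \<bullet> (A *\<^sub>v x) \<le> c * (x \<bullet> x)"
  using assms
proof (induction n arbitrary: A x)
  case 0
  thus ?case by (simp add: scalar_prod_def)
next
  case (Suc n)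
  obtain e v where v: "v \<in> carrier_vec (Suc n)" "v \<noteq> 0\<^sub>v (Suc n)" "A *\<^sub>v v = e \<cdot>\<^sub>v v"
    and ev: "eigenvalue A e"
    using real_symmetric_has_eigenvalue[OF Suc.prems(1,2)] Suc.prems(1)
    by (auto simp: eigenvalue_def eigenvector_def)
  obtain B where B: "B \<in> carrier_mat n n" "transpose_mat B = B"
    and cp: "char_poly A = [:- e, 1:] * char_poly B"
    and quad: "\<And>x. x \<in> carrier_vec (Suc n) \<Longrightarrow> \<exists>a. \<exists>y \<in> carrier_vec n.
       x \<bullet> x = a\<^sup>2 + y \<bullet> y \<and> x \<bullet> (A *\<^sub>v x) = e * a\<^sup>2 + y \<bullet> (B *\<^sub>v y) \<and> (x \<bullet> v = 0 \<longrightarrow> a = 0)"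
    using real_symmetric_deflation[OF Suc.prems(1,2) v] by blast
  obtain a y where y: "y \<in> carrier_vec n" "x \<bullet> x = a\<^sup>2 + y \<bullet> y"
    "x \<bullet> (A *\<^sub>v x) = e * a\<^sup>2 + y \<bullet> (B *\<^sub>v y)"
    using quad[OF Suc.prems(4)] by blast
  \<comment> \<open>By the factorization \<open>cp\<close>, roots of \<open>char_poly B\<close> are
    roots of \<open>char_poly A\<close>, so \<open>c\<close> bounds them too.\<close>
  have "y \<bullet> (B *\<^sub>v y) \<le> c * (y \<bullet> y)"
    by (rule Suc.IH[OF B _ y(1)]) (simp add: Suc.prems(3) cp)
  moreover have "e * a\<^sup>2 \<le> c * a\<^sup>2"
    by (intro mult_right_mono Suc.prems(3)) (simp_all add: cp)
  ultimately show ?case unfolding y by (simp add: algebra_simps)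
qed

text \<open>Deflating by a top eigenvector removes one copy of \<open>e\<close> from the spectrum,
  so the largest eigenvalue of \<open>B\<close> is the second of \<open>A\<close>, also when
  \<open>e\<close> is multiple. A vector orthogonal to \<open>v\<close> sees only
  \<open>B\<close>.\<close>

lemma rayleigh_quotient_le_second_eigenvalue:
  fixes A :: "real mat"
  assumes A: "A \<in> carrier_mat n n" "transpose_mat A = A" and n: "n \<ge> 2"
    and v: "v \<in> carrier_vec n" "v \<noteq> 0\<^sub>v n" "A *\<^sub>v v = e \<cdot>\<^sub>v v"
    and top: "\<And>r. eigenvalue A r \<Longrightarrow> r \<le> e"
    and x: "x \<in> carrier_vec n" "x \<bullet> v = 0"
  shows "x \<bullet> (A *\<^sub>v x) \<le> nth_eigenvalue 2 A * (x \<bullet> x)"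
proof -
  obtain m where m: "n = Suc m" "m > 0" using n by (cases n) auto
  obtain B where B: "B \<in> carrier_mat m m" "transpose_mat B = B"
    and cp: "char_poly A = [:- e, 1:] * char_poly B"
    and quad: "\<And>x. x \<in> carrier_vec (Suc m) \<Longrightarrow> \<exists>a. \<exists>y \<in> carrier_vec m.
       x \<bullet> x = a\<^sup>2 + y \<bullet> y \<and> x \<bullet> (A *\<^sub>v x) = e * a\<^sup>2 + y \<bullet> (B *\<^sub>v y) \<and> (x \<bullet> v = 0 \<longrightarrow> a = 0)"
    using real_symmetric_deflation[OF A[unfolded m] v[unfolded m]] by blast
  obtain y where y: "y \<in> carrier_vec m" "x \<bullet> x = y \<bullet> y" "x \<bullet> (A *\<^sub>v x) = y \<bullet> (B *\<^sub>v y)"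
    using quad[OF x(1)[unfolded m]] x(2) by auto
  have cB: "char_poly B \<noteq> 0"
    using degree_monic_char_poly[OF B(1)] by auto
  define es where "es = sorted_list_of_multiset (proots (char_poly B))"
  have set_es: "set es = {r. poly (char_poly B) r = 0}"
    using cB by (simp add: es_def)
  \<comment> \<open>From \<open>n \<ge> 2\<close> the block \<open>B\<close> has positive dimension,
    hence a real eigenvalue; so \<open>last es\<close> is a genuine element.\<close>
  have "es \<noteq> []"
    using real_symmetric_has_eigenvalue[OF B m(2)] eigenvalue_root_char_poly[OF B(1)] set_es
    by auto
  have "r \<le> e" if "r \<in> set es" for r
    using that top eigenvalue_root_char_poly[OF A(1), of r] set_es by (simp add: cp)
  \<comment> \<open>Entries of \<open>es\<close> may equal \<open>e\<close> but not exceed it, so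
    \<open>e\<close> may stand last in the ascending list and first in the descending one.\<close>
  hence "insort e es = es @ [e]"
    by (intro sorted_insort_is_snoc) (auto simp: es_def)
  moreover have "proots (char_poly A) = add_mset e (proots (char_poly B))"
    unfolding cp using cB by (subst proots_mult) auto
  ultimately have "eigenvalues_desc A = e # rev es"
    by (simp add: eigenvalues_desc_def es_def)
  \<comment> \<open>Counting from 1, eigenvalue 2 sits at list position 1, the head of
    \<open>rev es\<close>.\<close>
  hence nth: "nth_eigenvalue 2 A = last es"
    using \<open>es \<noteq> []\<close> by (simp add: nth_eigenvalue_def hd_rev[symmetric] hd_conv_nth)
  have "r \<le> last es" if "poly (char_poly B) r = 0" for r
  proof -
    have "r \<in> set es" using that set_es by simp
    moreover have "sorted es" by (simp add: es_def)
    ultimately show ?thesis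
      by (cases es rule: rev_cases) (auto simp: sorted_append)
  qed
  thus ?thesis unfolding y nth
    using rayleigh_quotient_le[OF B _ y(1)] by blast
qed

section \<open>Adjoints with respect to \<open>inner_pi\<close>\<close>

lemma inner_pi_commute: "inner_pi n \<pi> f g = inner_pi n \<pi> g f"
  by (simp add: inner_pi_def mult.commute)

lemma is_adjoint_pi_sym:
  assumes "is_adjoint_pi n \<pi> A B" "A \<in> carrier_mat n n"
  shows "is_adjoint_pi n \<pi> B A"
  using assms unfolding is_adjoint_pi_def by (metis inner_pi_commute)

lemma is_adjoint_pi_mult:
  assumes "is_adjoint_pi n \<pi> A B" "is_adjoint_pi n \<pi> C D"
    and "A \<in> carrier_mat n n" "C \<in> carrier_mat n n"
  shows "is_adjoint_pi n \<pi> (A * C) (D * B)"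
  using assms unfolding is_adjoint_pi_def
  by (auto simp: assoc_mult_mat_vec[of _ n n _ n] mult_mat_vec_carrier[of _ n n])

text \<open>The recursion of matrix powers appends the new factor on the right; adjoints reverse
  products, so it is needed on the left.\<close>

lemma pow_mat_Suc_left:
  fixes A :: "'a :: semiring_1 mat"
  assumes A: "A \<in> carrier_mat n n"
  shows "A ^\<^sub>m Suc t = A * A ^\<^sub>m t"
proof (induction t)
  case (Suc t)
  have "A ^\<^sub>m Suc (Suc t) = A * A ^\<^sub>m t * A" by (simp only: pow_mat.simps(2)[of A "Suc t"] Suc)
  thus ?case using A by (simp add: assoc_mult_mat[of _ n n _ n _ n])
qed (use A in simp)

lemma is_adjoint_pi_pow:
  assumes adj: "is_adjoint_pi n \<pi> A B" and A: "A \<in> carrier_mat n n"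
  shows "is_adjoint_pi n \<pi> (A ^\<^sub>m t) (B ^\<^sub>m t)"
proof (induction t)
  case 0
  thus ?case using assms by (auto simp: is_adjoint_pi_def)
next
  case (Suc t)
  have "B \<in> carrier_mat n n" using adj by (simp add: is_adjoint_pi_def)
  thus ?case
    using is_adjoint_pi_mult[OF Suc adj _ A] A pow_mat_Suc_left[of B n t] by simp
qed

section \<open>Stochastic matrices and their eigenvalues\<close>

lemma row_stochastic_one: "row_stochastic n (1\<^sub>m n)"
  by (auto simp: row_stochastic_def)

lemma row_stochastic_mult:
  assumes A: "row_stochastic n A" and B: "row_stochastic n B"
  shows "row_stochastic n (A * B)"
proof -
  have AB: "A \<in> carrier_mat n n" "B \<in> carrier_mat n n"
    using assms by (auto simp: row_stochastic_def)
  have entry: "(A * B) $$ (i, j) = (\<Sum>l<n. A $$ (i, l) * B $$ (l, j))" if "i < n" "j < n" for i j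
    using that AB by (simp add: scalar_prod_def atLeast0LessThan)
  have "(\<Sum>j<n. (A * B) $$ (i, j)) = 1" if i: "i < n" for i
  proof -
    have "(\<Sum>j<n. (A * B) $$ (i, j)) = (\<Sum>j<n. \<Sum>l<n. A $$ (i, l) * B $$ (l, j))"
      using i by (simp add: entry)
    also have "\<dots> = (\<Sum>l<n. A $$ (i, l) * (\<Sum>j<n. B $$ (l, j)))"
      unfolding sum_distrib_left by (rule sum.swap)
    also have "\<dots> = 1" using A B i by (simp add: row_stochastic_def)
    finally show ?thesis .
  qed
  moreover have "0 \<le> (A * B) $$ (i, j)" if "i < n" "j < n" for i j
    unfolding entry[OF that] using A B that by (auto simp: row_stochastic_def intro!: sum_nonneg)
  ultimately show ?thesis using AB by (auto simp: row_stochastic_def)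
qed

lemma row_stochastic_pow:
  assumes A: "row_stochastic n A"
  shows "row_stochastic n (A ^\<^sub>m t)"
proof (induction t)
  case 0
  have "dim_row A = n" using A by (auto simp: row_stochastic_def)
  thus ?case by (simp add: row_stochastic_one)
qed (simp add: A row_stochastic_mult)

text \<open>At a coordinate where an eigenvector attains its largest modulus \<open>m > 0\<close>,
  the eigenvalue equation takes an average of entries of modulus at most \<open>m\<close>, so
  \<open>\<bar>r\<bar> * m \<le> m\<close>.\<close>

lemma row_stochastic_eigenvalue_le_1:
  assumes M: "row_stochastic n M" and ev: "eigenvalue M r"
  shows "r \<le> 1"
proof -
  have C: "M \<in> carrier_mat n n" using M by (simp add: row_stochastic_def)
  obtain v where v: "v \<in> carrier_vec n" "v \<noteq> 0\<^sub>v n" "M *\<^sub>v v = r \<cdot>\<^sub>v v"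
    using ev C by (auto simp: eigenvalue_def eigenvector_def)
  then obtain l where l: "l < n" "v $ l \<noteq> 0"
    by (metis carrier_vecD eq_vecI index_zero_vec(1) zero_carrier_vec)
  define m where "m = Max ((\<lambda>i. \<bar>v $ i\<bar>) ` {..<n})"
  have le: "\<bar>v $ j\<bar> \<le> m" if "j < n" for j
    unfolding m_def using that by (intro Max_ge) auto
  have "m \<in> (\<lambda>i. \<bar>v $ i\<bar>) ` {..<n}"
    unfolding m_def using l by (intro Max_in) auto
  then obtain i where i: "i < n" "m = \<bar>v $ i\<bar>" by auto
  have m: "m > 0" using le[OF l(1)] l(2) by simp
  have "r * v $ i = (M *\<^sub>v v) $ i" using v i by simp
  also have "\<dots> = (\<Sum>j<n. M $$ (i, j) * v $ j)"
    using C v(1) i(1) by (simp add: scalar_prod_def atLeast0LessThan)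
  finally have "\<bar>r\<bar> * m \<le> (\<Sum>j<n. \<bar>M $$ (i, j) * v $ j\<bar>)"
    by (metis abs_mult i(2) sum_abs)
  also have "\<dots> \<le> (\<Sum>j<n. M $$ (i, j) * m)"
    using M i le by (intro sum_mono) (auto simp: abs_mult row_stochastic_def intro!: mult_left_mono)
  also have "\<dots> = m"
    using M i by (simp add: sum_distrib_right[symmetric] row_stochastic_def)
  finally show ?thesis using m by simp
qed

section \<open>Transfer of the spectral bound to the weighted inner product\<close>

lemma self_adjoint_stochastic_quadratic_form_le:
  assumes M: "row_stochastic n M" and adj: "is_adjoint_pi n \<pi> M M"
    and pos: "\<And>j. j < n \<Longrightarrow> \<pi> $ j > 0" and n: "n \<ge> 2"
    and x: "x \<in> carrier_vec n" "(\<Sum>j<n. x $ j * \<pi> $ j) = 0"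
  shows "inner_pi n \<pi> x (M *\<^sub>v x) \<le> nth_eigenvalue 2 M * inner_pi n \<pi> x x"
proof -
  have C: "M \<in> carrier_mat n n" using M by (simp add: row_stochastic_def)
  define s where "s = (\<lambda>j. sqrt (\<pi> $ j))"
  have s: "s j > 0" "s j * s j = \<pi> $ j" if "j < n" for j
    using pos[OF that] by (auto simp: s_def)
  define A where "A = mat n n (\<lambda>(i, j). s i * M $$ (i, j) / s j)"
  have A: "A \<in> carrier_mat n n" by (simp add: A_def)
  \<comment> \<open>Since the adjoint is unique, self-adjointness is detailed balance:
    \<open>M\<close> is reversible for \<open>\<pi>\<close>.\<close>
  have balance: "M $$ (i, j) = \<pi> $ j * M $$ (j, i) / \<pi> $ i" if "i < n" "j < n" for i j
    using is_adjoint_pi_iff[OF C pos] adj that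
    by (metis (no_types, lifting) case_prod_conv index_mat(1))
  have A_comm: "A $$ (j, i) = A $$ (i, j)" if "i < n" "j < n" for i j
    using that s(1)[OF that(1)] s(1)[OF that(2)] balance[OF that]
    by (simp add: A_def s(2)[symmetric] field_simps)
  have symA: "transpose_mat A = A"
    by (rule eq_matI) (use A A_comm in auto)
  have "A = mat_diag n s * M * mat_diag n (\<lambda>i. 1 / s i)"
    using C by (auto simp: A_def mat_diag_mult_left[of _ n n] mat_diag_mult_right[of _ n n] intro!: eq_matI)
  moreover have "mat_diag n s * mat_diag n (\<lambda>i. 1 / s i) = 1\<^sub>m n"
    "mat_diag n (\<lambda>i. 1 / s i) * mat_diag n s = 1\<^sub>m n"
    unfolding mat_diag_diag by (auto intro!: eq_matI simp: mat_diag_def dest!: s(1))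
  ultimately have sim: "similar_mat A M"
    using A C by (intro similar_matI[of _ _ _ _ n]) auto
  hence cp: "char_poly A = char_poly M" by (rule char_poly_similar)
  have A_mult: "(A *\<^sub>v vec n (\<lambda>j. s j * y $ j)) $ i = s i * (M *\<^sub>v y) $ i"
    if "i < n" "y \<in> carrier_vec n" for i y
  proof -
    have "(A *\<^sub>v vec n (\<lambda>j. s j * y $ j)) $ i = (\<Sum>j<n. s i * M $$ (i, j) / s j * (s j * y $ j))"
      using that A by (simp add: scalar_prod_def atLeast0LessThan A_def)
    also have "\<dots> = (\<Sum>j<n. s i * (M $$ (i, j) * y $ j))"
      using s(1) by (intro sum.cong) (auto dest!: s(1))
    also have "\<dots> = s i * (M *\<^sub>v y) $ i"
      using that C by (simp add: scalar_prod_def atLeast0LessThan sum_distrib_left)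
    finally show ?thesis .
  qed
  \<comment> \<open>An isometry from the weighted to the Euclidean inner product that intertwines
    \<open>M\<close> with \<open>A\<close>.\<close>
  define w where "w = (\<lambda>y :: real vec. vec n (\<lambda>j. s j * y $ j))"
  have w: "w y \<in> carrier_vec n" for y by (simp add: w_def)
  have Aw: "A *\<^sub>v w y = w (M *\<^sub>v y)" if "y \<in> carrier_vec n" for y
    unfolding w_def
  proof (rule eq_vecI)
    fix i assume "i < dim_vec (vec n (\<lambda>j. s j * (M *\<^sub>v y) $ j))"
    hence "i < n" by simp
    thus "(A *\<^sub>v vec n (\<lambda>j. s j * y $ j)) $ i = vec n (\<lambda>j. s j * (M *\<^sub>v y) $ j) $ i"
      unfolding A_mult[OF \<open>i < n\<close> that] by simp
  qed (use A in simp)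
  have w_prod: "w y \<bullet> w z = inner_pi n \<pi> y z" for y z
    by (auto simp: w_def scalar_prod_def inner_pi_def atLeast0LessThan s(2)[symmetric] intro!: sum.cong)
  define ones where "ones = vec n (\<lambda>_. 1 :: real)"
  have ones: "ones \<in> carrier_vec n" by (simp add: ones_def)
  have "M *\<^sub>v ones = ones"
    using M C by (auto intro!: eq_vecI simp: ones_def scalar_prod_def atLeast0LessThan row_stochastic_def)
  hence "A *\<^sub>v w ones = 1 \<cdot>\<^sub>v w ones" by (simp add: Aw ones)
  moreover have "w ones \<noteq> 0\<^sub>v n"
  proof
    assume "w ones = 0\<^sub>v n"
    hence "w ones $ 0 = 0" using n by simp
    thus False using n s(1)[of 0] by (simp add: w_def ones_def)
  qed
  moreover have "r \<le> 1" if "eigenvalue A r" for r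
    using that row_stochastic_eigenvalue_le_1[OF M]
    by (simp add: eigenvalue_root_char_poly[OF A] eigenvalue_root_char_poly[OF C] cp)
  \<comment> \<open>Pulled back along \<open>w\<close>, this is the mean-zero assumption on
    \<open>x\<close>.\<close>
  moreover have "w x \<bullet> w ones = 0"
    using x by (simp add: w_prod inner_pi_def ones_def)
  ultimately have "w x \<bullet> (A *\<^sub>v w x) \<le> nth_eigenvalue 2 A * (w x \<bullet> w x)"
    using rayleigh_quotient_le_second_eigenvalue[OF A symA n w] w by blast
  moreover have "nth_eigenvalue 2 A = nth_eigenvalue 2 M"
    by (simp add: nth_eigenvalue_def eigenvalues_desc_def cp)
  ultimately show ?thesis using x by (simp add: Aw w_prod)
qed

section \<open>Contraction of the chi-squared divergence\<close>

theorem theorem3p5: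
  fixes n :: nat and P :: "real mat" and \<pi> :: "real vec" and i k t :: nat
  assumes "n \<ge> 2"
    and "row_stochastic n P"
    and "irreducible_chain n P"
    and "aperiodic_chain n P"
    and "stationary_distribution n P \<pi>"
    and "\<forall>j<n. \<pi> $ j > 0"
    and "i < n"
  shows "chi2_div n P \<pi> i (k + t) \<le> (sigma_pow n \<pi> 2 P t)\<^sup>2 * chi2_div n P \<pi> i k"
proof -
  have P: "P \<in> carrier_mat n n" using assms(2) by (simp add: row_stochastic_def)
  have pos: "\<pi> $ j > 0" if "j < n" for j using assms(6) that by blast
  have \<pi>: "\<pi> \<in> carrier_vec n" "(\<Sum>j<n. \<pi> $ j) = 1" "transpose_mat P *\<^sub>v \<pi> = \<pi>"
    using assms(5) by (auto simp: stationary_distribution_def)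
  have stat: "(\<Sum>l<n. P $$ (l, j) * \<pi> $ l) = \<pi> $ j" if "j < n" for j
    using arg_cong[OF \<pi>(3), of "\<lambda>v. v $ j"] that P \<pi>(1)
    by (simp add: scalar_prod_def atLeast0LessThan)
  define Q where "Q = adjoint_pi n \<pi> P"
  have Q_eq: "Q = mat n n (\<lambda>(i, j). \<pi> $ j * P $$ (j, i) / \<pi> $ i)"
    unfolding Q_def using adjoint_pi_eq[OF P pos] .
  have Q: "Q \<in> carrier_mat n n" by (simp add: Q_eq)
  have adj: "is_adjoint_pi n \<pi> P Q"
    using is_adjoint_pi_iff[OF P pos] Q_eq by blast
  have adj_pow: "is_adjoint_pi n \<pi> (P ^\<^sub>m t) (Q ^\<^sub>m t)"
    by (rule is_adjoint_pi_pow[OF adj P])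
  \<comment> \<open>\<open>Q\<close> is the transition matrix of the time-reversed chain;
    stationarity of \<open>\<pi>\<close> makes its rows sum to 1.\<close>
  have Q_stoch: "row_stochastic n Q"
    unfolding row_stochastic_def
  proof (intro conjI allI impI)
    fix l assume l: "l < n"
    have "(\<Sum>j<n. Q $$ (l, j)) = (\<Sum>j<n. P $$ (j, l) * \<pi> $ j) / \<pi> $ l"
      unfolding sum_divide_distrib using l by (simp add: Q_eq mult.commute)
    thus "(\<Sum>j<n. Q $$ (l, j)) = 1" using stat[OF l] pos[OF l] by simp
    show "0 \<le> Q $$ (l, j)" if "j < n" for j
      using l that pos[OF l] pos[OF that] assms(2) by (simp add: Q_eq row_stochastic_def)
  qed (fact Q)
  define M where "M = P ^\<^sub>m t * Q ^\<^sub>m t"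
  have M_stoch: "row_stochastic n M"
    unfolding M_def by (intro row_stochastic_mult row_stochastic_pow assms(2) Q_stoch)
  have M_adj: "is_adjoint_pi n \<pi> M M"
    unfolding M_def using P Q
    by (intro is_adjoint_pi_mult adj_pow is_adjoint_pi_sym[OF adj_pow]) auto

  define z where "z = (\<lambda>m. vec n (\<lambda>j. (P ^\<^sub>m m) $$ (i, j) / \<pi> $ j - 1))"
  have z: "z m \<in> carrier_vec n" for m by (simp add: z_def)
  have chi2: "chi2_div n P \<pi> i m = inner_pi n \<pi> (z m) (z m)" for m
    unfolding chi2_div_def inner_pi_def
    by (intro sum.cong) (auto simp: z_def field_simps power2_eq_square dest!: pos)
  \<comment> \<open>\<open>Q\<close> moves densities with respect to \<open>\<pi>\<close> as
    \<open>P\<close> moves row distributions, and by stationarity it fixes the subtracted constant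
    1.\<close>
  have z_Suc: "z (Suc m) = Q *\<^sub>v z m" for m
  proof (rule eq_vecI)
    fix j assume "j < dim_vec (Q *\<^sub>v z m)"
    hence j: "j < n" using Q by simp
    have "(Q *\<^sub>v z m) $ j
        = (\<Sum>l<n. \<pi> $ l * P $$ (l, j) / \<pi> $ j * ((P ^\<^sub>m m) $$ (i, l) / \<pi> $ l - 1))"
      using j by (simp add: Q_eq z_def scalar_prod_def atLeast0LessThan)
    also have "\<dots> = (\<Sum>l<n. (P ^\<^sub>m m) $$ (i, l) * P $$ (l, j) / \<pi> $ j - P $$ (l, j) * \<pi> $ l / \<pi> $ j)"
      using pos[OF j] by (intro sum.cong) (auto simp: field_simps dest!: pos)
    also have "\<dots> = (P ^\<^sub>m Suc m) $$ (i, j) / \<pi> $ j - \<pi> $ j / \<pi> $ j"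
      unfolding sum_subtractf sum_divide_distrib[symmetric] stat[OF j]
      using assms(7) j P by (simp add: scalar_prod_def atLeast0LessThan)
    finally show "z (Suc m) $ j = (Q *\<^sub>v z m) $ j"
      using j pos[OF j] by (simp add: z_def)
  qed (use Q in \<open>simp add: z_def\<close>)
  have z_add: "z (k + m) = Q ^\<^sub>m m *\<^sub>v z k" for m
  proof (induction m)
    case (Suc m)
    thus ?case using Q z[of k] pow_mat_Suc_left[OF Q, of m]
      by (simp add: z_Suc assoc_mult_mat_vec[of _ n n _ n])
  qed (use Q z in simp)
  \<comment> \<open>The row of \<open>P ^\<^sub>m k\<close> and \<open>\<pi>\<close> both have total
    mass 1.\<close>
  have "(\<Sum>j<n. z k $ j * \<pi> $ j) = (\<Sum>j<n. (P ^\<^sub>m k) $$ (i, j) - \<pi> $ j)"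
    by (intro sum.cong) (auto simp: z_def field_simps dest!: pos)
  also have "\<dots> = 0"
    using row_stochastic_pow[OF assms(2), of k] assms(7)
    by (simp add: sum_subtractf \<pi>(2) row_stochastic_def)
  finally have z_orth: "(\<Sum>j<n. z k $ j * \<pi> $ j) = 0" .

  \<comment> \<open>In the squared norm of \<open>Q ^\<^sub>m t *\<^sub>v z k\<close>, one factor
    \<open>Q ^\<^sub>m t\<close> is moved across as its adjoint
    \<open>P ^\<^sub>m t\<close>.\<close>
  have "chi2_div n P \<pi> i (k + t) = inner_pi n \<pi> (z k) (M *\<^sub>v z k)"
  proof -
    have "Q ^\<^sub>m t *\<^sub>v z k \<in> carrier_vec n" using z[of "k + t"] by (simp add: z_add)
    thus ?thesis
      using is_adjoint_pi_sym[OF adj_pow] P Q z[of k]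
      by (simp add: chi2 z_add M_def is_adjoint_pi_def assoc_mult_mat_vec[of _ n n _ n])
  qed
  also have "\<dots> \<le> nth_eigenvalue 2 M * inner_pi n \<pi> (z k) (z k)"
    by (rule self_adjoint_stochastic_quadratic_form_le[OF M_stoch M_adj pos assms(1) z z_orth])
  also have "\<dots> \<le> (sigma_pow n \<pi> 2 P t)\<^sup>2 * inner_pi n \<pi> (z k) (z k)"
  proof (rule mult_right_mono)
    \<comment> \<open>HOL's \<open>sqrt\<close> is odd, so the square of a square root is the absolute value.\<close>
    have "(sigma_pow n \<pi> 2 P t)\<^sup>2 = \<bar>nth_eigenvalue 2 M\<bar>"
      by (simp add: sigma_pow_def M_def Q_def real_sqrt_power[symmetric] real_sqrt_abs)
    thus "nth_eigenvalue 2 M \<le> (sigma_pow n \<pi> 2 P t)\<^sup>2" by simp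
    show "0 \<le> inner_pi n \<pi> (z k) (z k)"
      unfolding chi2[symmetric] chi2_div_def by (intro sum_nonneg divide_nonneg_pos) (auto intro: pos)
  qed
  finally show ?thesis by (simp add: chi2)
qed

end
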